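(* Let $\{a_i\}_{i=0}^{n}$ be a unimodal sequence of non-negative real numbers such that $$\sum_{i=0}^{n}(-1)^i a_i=0 .$$ Then for every positive integer $k$, $$\sum_{i=0}^{2k}(-1)^i a_i\;\ge\;0\qquad\text{and}\qquad\sum_{i=0}^{2k-1}(-1)^i a_i\;\le\;0,$$ where $a_i$ is taken to be $0$ for $i>n$.
   Context: A finite sequence $\{a_i\}_{i=0}^{n}$ of real numbers is unimodal if there is an index $0\le j\le n$ such that $a_0\le a_1\le\cdots\le a_{j-1}\le a_j\ge a_{j+1}\ge\cdots\ge a_n$. *)

theory Defs
  imports Complex_Main
begin

(* Only the values a 0, ..., a n matter; a is otherwise an arbitrary total function. *)
definition unimodal :: "nat \<Rightarrow> (nat \<Rightarrow> real) \<Rightarrow> bool" where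
  "unimodal n a \<longleftrightarrow>
     (\<exists>j\<le>n. (\<forall>i<j. a i \<le> a (Suc i)) \<and> (\<forall>i. j \<le> i \<and> i < n \<longrightarrow> a i \<ge> a (Suc i)))"

end

theory Submission
  imports Defs
begin

text \<open>
  Extend the sequence by zero to \<open>b\<close> and weight each partial alternating sum by the sign of its last
  term: \<open>R m = (-1)^m * (b 0 - b 1 + ... \<plusminus> b m)\<close>. The claim is that \<open>R m \<ge> 0\<close> for every \<open>m\<close>; the two
  inequalities are its instances at an even and at an odd index. The recursion
  \<open>R (m + 1) = b (m + 1) - R m\<close> gives this on both sides of the peak. Up to the peak it traps
  \<open>R m\<close> between \<open>0\<close> and \<open>b m\<close>, starting from \<open>R 0 = b 0\<close>. From the peak on it is run backwards and
  traps \<open>R m\<close> between \<open>0\<close> and \<open>b (m + 1)\<close>, starting from \<open>R n = 0\<close>, which is the hypothesis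
  that the full alternating sum vanishes.
\<close>

definition signed_alt_sum :: "(nat \<Rightarrow> real) \<Rightarrow> nat \<Rightarrow> real" where
  "signed_alt_sum b m = (-1) ^ m * (\<Sum>i=0..m. (-1) ^ i * b i)"

lemma signed_alt_sum_0: "signed_alt_sum b 0 = b 0"
  by (simp add: signed_alt_sum_def)

lemma signed_alt_sum_Suc: "signed_alt_sum b (Suc m) = b (Suc m) - signed_alt_sum b m"
proof -
  have "(-1::real) ^ m * (-1) ^ m = 1"
    by (simp flip: power_mult_distrib)
  then show ?thesis
    by (simp add: signed_alt_sum_def algebra_simps)
qed

text \<open>
  The upper bound is what carries the induction: it makes the next signed sum at least the
  increment \<open>b (m + 1) - b m\<close>.
\<close>

lemma signed_alt_sum_increasing:
  assumes "b 0 \<ge> 0" and "\<And>i. i < m \<Longrightarrow> b i \<le> b (Suc i)"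
  shows "0 \<le> signed_alt_sum b m \<and> signed_alt_sum b m \<le> b m"
  using assms
proof (induction m)
  case 0
  then show ?case by (simp add: signed_alt_sum_0)
next
  case (Suc m)
  then have "0 \<le> signed_alt_sum b m" "signed_alt_sum b m \<le> b m" "b m \<le> b (Suc m)"
    by auto
  then show ?case by (simp add: signed_alt_sum_Suc)
qed

text \<open>
  When the sum up to \<open>n\<close> vanishes, the signed sum at \<open>m\<close> is the alternating tail
  \<open>b (m + 1) - b (m + 2) + ...\<close> up to \<open>b n\<close>. Its terms decrease, so it lies between \<open>0\<close> and its
  first term, as in the alternating series test.
\<close>

lemma signed_alt_sum_decreasing:
  assumes "m \<le> n" and "signed_alt_sum b n = 0" and "b (Suc n) \<ge> 0"
    and "\<And>i. m < i \<Longrightarrow> i \<le> n \<Longrightarrow> b (Suc i) \<le> b i"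
  shows "0 \<le> signed_alt_sum b m \<and> signed_alt_sum b m \<le> b (Suc m)"
  using assms(1)
proof (induction rule: inc_induct)
  case base
  show ?case using assms(2,3) by simp
next
  case (step i)
  then have "b (Suc (Suc i)) \<le> b (Suc i)"
    by (intro assms(4)) auto
  then show ?case using step.IH by (simp add: signed_alt_sum_Suc)
qed

lemma signed_alt_sum_zero_extension_nonneg:
  fixes a :: "nat \<Rightarrow> real"
  assumes "unimodal n a"
    and nonneg: "\<forall>i\<le>n. a i \<ge> 0"
    and total: "(\<Sum>i=0..n. (-1) ^ i * a i) = 0"
  shows "signed_alt_sum (\<lambda>i. if i \<le> n then a i else 0) m \<ge> 0"
proof -
  define b where "b = (\<lambda>i. if i \<le> n then a i else 0)"
  obtain j where j: "j \<le> n" "\<And>i. i < j \<Longrightarrow> a i \<le> a (Suc i)"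
      "\<And>i. j \<le> i \<Longrightarrow> i < n \<Longrightarrow> a (Suc i) \<le> a i"
    using assms(1) unfolding unimodal_def by blast
  have "signed_alt_sum b m \<ge> 0"
  proof (cases "m \<le> j")
    case True
    then show ?thesis
      using signed_alt_sum_increasing[of b m] j(1,2) nonneg by (simp add: b_def)
  next
    case False
    define N where "N = max m n"
    have "(\<Sum>i=0..N. (-1) ^ i * b i) = (\<Sum>i=0..n. (-1) ^ i * a i)"
      by (rule sum.mono_neutral_cong_right) (auto simp: b_def N_def)
    then have "signed_alt_sum b N = 0"
      using total by (simp add: signed_alt_sum_def)
    \<comment> \<open>Non-negativity of \<open>a n\<close> makes the extension decrease at \<open>n\<close> as well.\<close>
    moreover have "b (Suc i) \<le> b i" if "m < i" for i
      using that False j(3)[of i] nonneg by (auto simp: b_def)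
    moreover have "m \<le> N" "b (Suc N) \<ge> 0"
      by (auto simp: N_def b_def)
    ultimately show ?thesis
      using signed_alt_sum_decreasing[of m N b] by blast
  qed
  then show ?thesis by (simp add: b_def)
qed

theorem theorem2:
  fixes a :: "nat \<Rightarrow> real" and n k :: nat
  assumes "unimodal n a"
    and "\<forall>i\<le>n. a i \<ge> 0"
    and "(\<Sum>i=0..n. (-1) ^ i * a i) = 0"
    and "k > 0"
  shows "(\<Sum>i=0..2 * k. (-1) ^ i * (if i \<le> n then a i else 0)) \<ge> 0 \<and>
         (\<Sum>i=0..2 * k - 1. (-1) ^ i * (if i \<le> n then a i else 0)) \<le> 0"
proof -
  note nonneg = signed_alt_sum_zero_extension_nonneg[OF assms(1-3), unfolded signed_alt_sum_def]
  have "(-1::real) ^ (2 * k - 1) = -1"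
    using assms(4) by simp
  then show ?thesis
    using nonneg[of "2 * k"] nonneg[of "2 * k - 1"] by simp
qed

end
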